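(* Let $p\ge 1$ be an integer, let $\alpha=(\alpha_1,\dots,\alpha_p)$ with $\alpha_i\in(0,\infty)\setminus\mathbb{N}$ for every $i\in\{1,\dots,p\}$, let $m\in\mathbb{N}$, and let $\mathbf{f}:[0,\infty)\times\mathbb{R}^{p(m+1)}\to\mathbb{R}^p$ be a given function. Consider the fractional-order differential system $$D^{\alpha}\mathbf{x}(t)=\mathbf{f}(t,\mathbf{x}(t),\mathbf{x}'(t),\dots,\mathbf{x}^{(m)}(t)),\qquad t\ge 0,$$ where $D^{\alpha}\mathbf{x}(t)=(D^{\alpha_1}x_1(t),\dots,D^{\alpha_p}x_p(t))^T$ and $D^{\alpha_i}$, $i\in\{1,\dots,p\}$, is understood as one of the Riemann-Liouville, Caputo or Grunwald-Letnikov fractional-order derivatives. Let $T>0$ and let $k\ge 1$ be an integer. Assume that $\mathbf{f}$ is $T$-periodic with respect to its first argument. Then there are no non-constant $kT$-periodic solutions of class $C^{\mathbf{n}}$ of this system, where $\mathbf{n}=([\alpha_1]+1,\dots,[\alpha_p]+1)$.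
   Context: $[\cdot]$ denotes the integer part. A function $\mathbf{x}=(x_1,\dots,x_p)^T:[0,\infty)\to\mathbb{R}^p$ is of class $C^{\mathbf{n}}$, with $\mathbf{n}=(n_1,\dots,n_p)$, if each $x_i$ is $n_i$ times continuously differentiable. It is $\tau$-periodic if $\mathbf{x}(t+\tau)=\mathbf{x}(t)$ for all $t\ge 0$. A solution is a function $\mathbf{x}$ for which the derivatives appearing in the system exist and the system is satisfied. For $\beta\in(0,\infty)\setminus\mathbb{N}$, $n=[\beta]+1$ and $g$ of class $C^n$, the fractional-order derivatives of order $\beta$ with lower limit $0$ are: Riemann-Liouville: $${}^{RL}D^{\beta}g(t)=\frac{1}{\Gamma(n-\beta)}\left(\frac{d}{dt}\right)^n\int_0^t (t-s)^{n-\beta-1}g(s)\,ds;$$ Caputo: $${}^{C}D^{\beta}g(t)=\frac{1}{\Gamma(n-\beta)}\int_0^t (t-s)^{n-\beta-1}g^{(n)}(s)\,ds;$$ Grunwald-Letnikov: $${}^{GL}D^{\beta}g(t)=\lim_{h\to 0}h^{-\beta}\sum_{r=0}^{[t/h]}(-1)^r\binom{\beta}{r}g(t-rh),$$ where the limit is taken over $h>0$ and $\binom{\beta}{r}=\frac{\beta(\beta-1)\cdots(\beta-r+1)}{r!}$. *)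

theory Defs
  imports "HOL-Analysis.Analysis"
begin

(* Functions on [0,\<infinity>) are total functions on the reals whose values at negative arguments are
   irrelevant: every derivative is taken within {0..}, hence one-sided at 0. *)

definition nth_deriv :: "nat \<Rightarrow> (real \<Rightarrow> 'a::real_normed_vector) \<Rightarrow> real \<Rightarrow> 'a" where
  "nth_deriv n g = ((\<lambda>h t. vector_derivative h (at t within {0..})) ^^ n) g"

definition times_differentiable :: "nat \<Rightarrow> (real \<Rightarrow> 'a::real_normed_vector) \<Rightarrow> bool" where
  "times_differentiable n g \<longleftrightarrow> (\<forall>j<n. nth_deriv j g differentiable_on {0..})"

definition class_C :: "nat ^ 'p \<Rightarrow> (real \<Rightarrow> real ^ 'p) \<Rightarrow> bool" where
  "class_C n x \<longleftrightarrow> (\<forall>i. times_differentiable (n $ i) (\<lambda>t. x t $ i) \<and>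
     continuous_on {0..} (nth_deriv (n $ i) (\<lambda>t. x t $ i)))"

definition deriv_order :: "real \<Rightarrow> nat" where
  "deriv_order \<beta> = nat \<lfloor>\<beta>\<rfloor> + 1"

definition RL_kernel :: "real \<Rightarrow> (real \<Rightarrow> real) \<Rightarrow> real \<Rightarrow> real \<Rightarrow> real" where
  "RL_kernel \<beta> g t s = (t - s) powr (real (deriv_order \<beta>) - \<beta> - 1) * g s"

definition Caputo_kernel :: "real \<Rightarrow> (real \<Rightarrow> real) \<Rightarrow> real \<Rightarrow> real \<Rightarrow> real" where
  "Caputo_kernel \<beta> g t s =
     (t - s) powr (real (deriv_order \<beta>) - \<beta> - 1) * nth_deriv (deriv_order \<beta>) g s"

definition GL_quotient :: "real \<Rightarrow> (real \<Rightarrow> real) \<Rightarrow> real \<Rightarrow> real \<Rightarrow> real" where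
  "GL_quotient \<beta> g t h =
     h powr (- \<beta>) * (\<Sum>r=0..nat \<lfloor>t / h\<rfloor>. (-1) ^ r * (\<beta> gchoose r) * g (t - real r * h))"

datatype frac_kind = Riemann_Liouville | Caputo | Grunwald_Letnikov

fun frac_deriv :: "frac_kind \<Rightarrow> real \<Rightarrow> (real \<Rightarrow> real) \<Rightarrow> real \<Rightarrow> real" where
  "frac_deriv Riemann_Liouville \<beta> g t =
     1 / Gamma (real (deriv_order \<beta>) - \<beta>) *
       nth_deriv (deriv_order \<beta>) (\<lambda>u. integral {0..u} (RL_kernel \<beta> g u)) t"
| "frac_deriv Caputo \<beta> g t =
     1 / Gamma (real (deriv_order \<beta>) - \<beta>) * integral {0..t} (Caputo_kernel \<beta> g t)"
| "frac_deriv Grunwald_Letnikov \<beta> g t = Lim (at_right 0) (GL_quotient \<beta> g t)"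

(* frac_deriv is total; the following says that it is meaningful at every t \<ge> 0. *)

fun frac_deriv_exists :: "frac_kind \<Rightarrow> real \<Rightarrow> (real \<Rightarrow> real) \<Rightarrow> bool" where
  "frac_deriv_exists Riemann_Liouville \<beta> g \<longleftrightarrow>
     (\<forall>t\<ge>0. RL_kernel \<beta> g t integrable_on {0..t}) \<and>
     times_differentiable (deriv_order \<beta>) (\<lambda>u. integral {0..u} (RL_kernel \<beta> g u))"
| "frac_deriv_exists Caputo \<beta> g \<longleftrightarrow>
     times_differentiable (deriv_order \<beta>) g \<and>
     (\<forall>t\<ge>0. Caputo_kernel \<beta> g t integrable_on {0..t})"
| "frac_deriv_exists Grunwald_Letnikov \<beta> g \<longleftrightarrow>
     (\<forall>t\<ge>0. \<exists>l. (GL_quotient \<beta> g t \<longlongrightarrow> l) (at_right 0))"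

(* An element (y_0, ..., y_m) of R^(p(m+1)) is an extensional function in {..m} \<rightarrow>\<^sub>E UNIV with
   values in R^p. The kind of fractional derivative may differ from component to component. *)

definition is_solution ::
  "('p \<Rightarrow> frac_kind) \<Rightarrow> real ^ 'p \<Rightarrow> nat \<Rightarrow>
   (real \<Rightarrow> (nat \<Rightarrow> real ^ 'p) \<Rightarrow> real ^ 'p) \<Rightarrow> (real \<Rightarrow> real ^ 'p) \<Rightarrow> bool" where
  "is_solution D \<alpha> m f x \<longleftrightarrow>
     (\<forall>i. frac_deriv_exists (D i) (\<alpha> $ i) (\<lambda>t. x t $ i)) \<and>
     times_differentiable m x \<and>
     (\<forall>t\<ge>0. (\<chi> i. frac_deriv (D i) (\<alpha> $ i) (\<lambda>s. x s $ i) t) =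
            f t (\<lambda>j\<in>{..m}. nth_deriv j x t))"

definition periodic :: "real \<Rightarrow> (real \<Rightarrow> 'a) \<Rightarrow> bool" where
  "periodic \<tau> x \<longleftrightarrow> (\<forall>t\<ge>0. x (t + \<tau>) = x t)"

end

theory Submission
  imports Defs
begin

text \<open>Let \<open>S = k T\<close> and let \<open>g\<close> be a component of an \<open>S\<close>-periodic solution. The right-hand side of the
  system is \<open>S\<close>-periodic along the solution, so the fractional derivative of \<open>g\<close> is, too. Its memory
  reaches back to \<open>0\<close>, so moving from \<open>t\<close> to \<open>t + S\<close> adds exactly the contribution of one more period:
  a nonzero multiple of the integral of \<open>(t + S - s) powr b * v s\<close> over \<open>s \<in> {0..S}\<close> with \<open>b < 0\<close>,
  where \<open>v\<close> is \<open>g\<close> (Riemann-Liouville, Grunwald-Letnikov) or its top derivative (Caputo).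
  This vanishes for all \<open>t > 0\<close>, which forces \<open>v = 0\<close> because the kernels span a dense space.\<close>

section \<open>Injectivity of the power transform over one period\<close>

text \<open>The argument is \<open>t\<close> rather than \<open>t + S\<close> because for
  \<open>t > 0\<close> the base \<open>t + S - s\<close> stays at least \<open>t\<close> on
  \<open>{0..S}\<close>. The integrand is then regular for every real \<open>b\<close>, including
  the exponents below -1 that differentiation produces.\<close>

definition power_transform :: "real \<Rightarrow> (real \<Rightarrow> real) \<Rightarrow> real \<Rightarrow> real \<Rightarrow> real" where
  "power_transform S v b t = integral {0..S} (\<lambda>s. (t + S - s) powr b * v s)"

lemma continuous_on_power_transform_integrand:
  assumes "continuous_on {0..S} v" "0 < (t::real)"
  shows "continuous_on {0..S} (\<lambda>s. (t + S - s) powr b * v s)"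
  using assms by (intro continuous_intros) auto

text \<open>Differentiation under the integral sign. The family of transforms is closed under it,
  each derivative lowering the exponent by one.\<close>

lemma has_real_derivative_power_transform:
  assumes v: "continuous_on {0..S} v" and t: "0 < t"
  shows "(power_transform S v b has_real_derivative b * power_transform S v (b - 1) t) (at t)"
proof -
  \<comment> \<open>The Leibniz rule wants a convex domain. On the open half-line
    \<open>{0<..}\<close> the derivative within the set is the ordinary one.\<close>
  have "((\<lambda>x. integral (cbox 0 S) (\<lambda>s. (x + S - s) powr b * v s)) has_field_derivative
      integral (cbox 0 S) (\<lambda>s. b * (t + S - s) powr (b - 1) * v s)) (at t within {0<..})"
  proof (rule leibniz_rule_field_derivative[where fx = "\<lambda>x s. b * (x + S - s) powr (b - 1) * v s"])
    fix x s :: real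
    assume "x \<in> {0<..}" "s \<in> cbox 0 S"
    then have "x + S - s > 0" by auto
    then show "((\<lambda>x. (x + S - s) powr b * v s) has_field_derivative
        b * (x + S - s) powr (b - 1) * v s) (at x within {0<..})"
      by (auto intro!: derivative_eq_intros simp: field_simps)
  next
    fix x :: real
    assume "x \<in> {0<..}"
    then show "(\<lambda>s. (x + S - s) powr b * v s) integrable_on cbox 0 S"
      using continuous_on_power_transform_integrand[OF v]
      by (auto intro!: integrable_continuous_real)
  next
    show "continuous_on ({0<..} \<times> cbox 0 S) (\<lambda>(x, s). b * (x + S - s) powr (b - 1) * v s)"
      unfolding case_prod_beta
      by (intro continuous_intros continuous_on_compose2[OF v]) auto
  qed (use t in auto)
  moreover have "integral {0..S} (\<lambda>s. b * (t + S - s) powr (b - 1) * v s)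
      = b * power_transform S v (b - 1) t"
    by (simp add: power_transform_def mult.assoc)
  ultimately show ?thesis
    using t by (simp add: power_transform_def[abs_def] at_within_open[of t "{0<..}"])
qed

text \<open>All derivatives of the zero function are zero, and the factor \<open>b - j\<close>
  produced at each differentiation can be cancelled because \<open>b < 0\<close>.\<close>

lemma power_transform_lower_exponents_zero:
  assumes v: "continuous_on {0..S} v" and b: "b < 0"
    and zero: "\<And>t. 0 < t \<Longrightarrow> power_transform S v b t = 0" and t: "0 < t"
  shows "power_transform S v (b - real j) t = 0"
  using t
proof (induction j arbitrary: t)
  case (Suc j)
  have "((\<lambda>_. 0) has_real_derivative (b - j) * power_transform S v (b - j - 1) t) (at t)"
    using has_real_derivative_power_transform[OF v Suc.prems, of "b - j"]
    by (rule has_field_derivative_transform_within_open[where S = "{0<..}"])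
      (use Suc in auto)
  then have "(b - j) * power_transform S v (b - j - 1) t = 0"
    by (rule DERIV_unique) simp
  then show ?case
    using b by (simp add: algebra_simps)
qed (use zero in simp)

text \<open>Differentiating in \<open>t\<close> and then setting \<open>t = 1\<close> makes \<open>h s = (1 + S - s) powr b * v s\<close>
  orthogonal to all polynomials in \<open>1 / (1 + S - s)\<close>, hence by Weierstrass to itself.\<close>

lemma power_transform_eq_0_imp_eq_0:
  assumes v: "continuous_on {0..S} v" and S: "0 < S" and b: "b < 0"
    and zero: "\<And>t. 0 < t \<Longrightarrow> power_transform S v b t = 0" and s: "s \<in> {0..S}"
  shows "v s = 0"
proof -
  define h where "h = (\<lambda>s. (1 + S - s) powr b * v s)"
  define w where "w = (\<lambda>s. 1 / (1 + S - s))"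
  have h: "continuous_on {0..S} h"
    unfolding h_def by (rule continuous_on_power_transform_integrand[OF v]) simp
  have w: "continuous_on {0..S} w"
    unfolding w_def by (intro continuous_intros) auto
  have moment: "integral {0..S} (\<lambda>s. h s * w s ^ j) = 0" for j
  proof -
    have "integral {0..S} (\<lambda>s. h s * w s ^ j) = power_transform S v (b - real j) 1"
      unfolding power_transform_def
      by (rule integral_cong)
        (auto simp: h_def w_def powr_diff powr_realpow power_divide)
    then show ?thesis
      using power_transform_lower_exponents_zero[OF v b zero, of 1 j] by simp
  qed
  have poly: "integral {0..S} (\<lambda>s. h s * P (w s)) = 0"
    if P: "real_polynomial_function P" for P
  proof -
    obtain a n where "P = (\<lambda>x. \<Sum>i\<le>n. a i * x ^ i)"
      using P unfolding real_polynomial_function_iff_sum by blast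
    then have "integral {0..S} (\<lambda>s. h s * P (w s))
        = integral {0..S} (\<lambda>s. \<Sum>i\<le>n. a i * (h s * w s ^ i))"
      by (simp add: sum_distrib_left mult.left_commute)
    also have "\<dots> = (\<Sum>i\<le>n. integral {0..S} (\<lambda>s. a i * (h s * w s ^ i)))"
      by (rule integral_sum) (auto intro!: integrable_continuous_real continuous_intros h w)
    finally show ?thesis
      by (simp add: moment)
  qed
  have h2: "(\<lambda>s. h s * h s) integrable_on {0..S}"
    by (intro integrable_continuous_real continuous_intros h)
  have "integral {0..S} (\<lambda>s. h s * h s) \<le> 0 + e" if e: "0 < e" for e
  proof -
    \<comment> \<open>The inverse of \<open>w\<close> is \<open>1 + S - 1 / y\<close>, so
      \<open>q\<close> is \<open>h\<close> expressed in the variable \<open>y = w s\<close>. A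
      polynomial \<open>P\<close> close to \<open>q\<close> on the range of \<open>w\<close> makes
      \<open>P (w s)\<close> close to \<open>h s\<close>.\<close>
    define q where "q = (\<lambda>y. h (1 + S - 1 / y))"
    have habs: "(\<lambda>s. \<bar>h s\<bar>) integrable_on {0..S}"
      by (intro integrable_continuous_real continuous_intros h)
    \<comment> \<open>The summand 1 keeps \<open>C\<close> positive even if \<open>h\<close>
      vanishes identically.\<close>
    define C where "C = integral {0..S} (\<lambda>s. \<bar>h s\<bar>) + 1"
    have C: "C > 0"
      unfolding C_def by (rule add_nonneg_pos) (auto intro: integral_nonneg habs)
    have "continuous_on {1 / (1 + S)..1} q"
      unfolding q_def
    proof (intro continuous_on_compose2[OF h] continuous_intros)
      show "(\<lambda>y. 1 + S - 1 / y) ` {1 / (1 + S)..1} \<subseteq> {0..S}"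
      proof (clarsimp, intro conjI)
        fix y assume y: "1 / (1 + S) \<le> y" "y \<le> 1"
        have "0 < 1 / (1 + S)" using S by simp
        with y have "0 < y" by linarith
        with y S show "1 / y \<le> 1 + S" "1 \<le> 1 / y" 
          by (auto simp: field_simps)
      qed
      have "0 < 1 / (1 + S)" using S by simp
      then show "\<forall>x\<in>{1 / (1 + S)..1}. x \<noteq> 0" by force
    qed
    then obtain P where P: "real_polynomial_function P"
      "\<And>y. y \<in> {1 / (1 + S)..1} \<Longrightarrow> \<bar>q y - P y\<bar> < e / C"
      using Stone_Weierstrass_real_polynomial_function[of "{1 / (1 + S)..1}" q "e / C"] e C by auto
    have close: "\<bar>h s - P (w s)\<bar> \<le> e / C" if "s \<in> {0..S}" for s
    proof -
      have "w s \<in> {1 / (1 + S)..1}"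
        using that by (auto simp: w_def field_simps)
      moreover have "q (w s) = h s"
        by (simp add: q_def w_def)
      ultimately show ?thesis
        using P(2)[of "w s"] by simp
    qed
    have Pw: "continuous_on {0..S} (\<lambda>s. P (w s))"
      by (rule continuous_on_compose2[OF continuous_on_polymonial_function w, of P UNIV])
        (use P(1) in \<open>auto simp: real_polynomial_function_eq\<close>)
    \<comment> \<open>By \<open>poly\<close> the subtracted integral is 0. What remains is the
      integral of \<open>h * (h - P o w)\<close>, bounded by \<open>e / C\<close> times the integral
      of the absolute value of \<open>h\<close>, that is, by
      \<open>(C - 1) * (e / C)\<close>.\<close>
    have "integral {0..S} (\<lambda>s. h s * h s)
        = integral {0..S} (\<lambda>s. h s * h s) - integral {0..S} (\<lambda>s. h s * P (w s))"
      by (simp add: poly P(1))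
    also have "\<dots> = integral {0..S} (\<lambda>s. h s * h s - h s * P (w s))"
      by (rule integral_diff[symmetric])
        (auto intro!: integrable_continuous_real continuous_intros h Pw)
    also have "\<dots> \<le> integral {0..S} (\<lambda>s. \<bar>h s\<bar> * (e / C))"
    proof (rule integral_le)
      fix s assume "s \<in> {0..S}"
      have "h s * h s - h s * P (w s) = h s * (h s - P (w s))"
        by (simp add: algebra_simps)
      also have "\<dots> \<le> \<bar>h s\<bar> * \<bar>h s - P (w s)\<bar>"
        by (metis abs_ge_self abs_mult)
      also have "\<dots> \<le> \<bar>h s\<bar> * (e / C)"
        by (intro mult_left_mono close \<open>s \<in> {0..S}\<close>) simp
      finally show "h s * h s - h s * P (w s) \<le> \<bar>h s\<bar> * (e / C)" .
    qed (use C in \<open>auto intro!: integrable_continuous_real continuous_intros h Pw\<close>)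
    also have "\<dots> = (C - 1) * (e / C)"
      by (simp add: C_def)
    also have "\<dots> \<le> e"
      using e C by (simp add: field_simps)
    finally show ?thesis by simp
  qed
  then have "integral {0..S} (\<lambda>s. h s * h s) \<le> 0"
    by (rule field_le_epsilon)
  moreover have "integral {0..S} (\<lambda>s. h s * h s) \<ge> 0"
    by (intro integral_nonneg h2) auto
  ultimately have "\<forall>x\<in>{0..S}. h x * h x = 0"
    by (subst integral_eq_0_iff[symmetric]) (auto intro!: continuous_intros h S)
  then have "h s = 0"
    using s by auto
  then show ?thesis
    using s by (simp add: h_def)
qed

section \<open>Iterated derivatives on the half-line and periodicity\<close>

lemma nth_deriv_0 [simp]: "nth_deriv 0 g = g"
  by (simp add: nth_deriv_def)

lemma nth_deriv_Suc:
  "nth_deriv (Suc n) g = (\<lambda>t. vector_derivative (nth_deriv n g) (at t within {0..}))"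
  by (simp add: nth_deriv_def)

text \<open>This makes derivatives within \<open>{0..}\<close> unique, also at the end point
  0.\<close>

lemma at_within_atLeast_neq_bot: "0 \<le> t \<Longrightarrow> at t within {0::real..} \<noteq> bot"
  using islimpt_subset[of t "{t<..<t+1}" "{0..}"]
  by (simp add: trivial_limit_within islimpt_greaterThanLessThan1 subset_iff)

lemma times_differentiable_has_vector_derivative:
  assumes "times_differentiable n g" "j < n" "0 \<le> t"
  shows "(nth_deriv j g has_vector_derivative nth_deriv (Suc j) g t) (at t within {0..})"
  using assms unfolding times_differentiable_def differentiable_on_def nth_deriv_Suc
  by (simp add: vector_derivative_works)

lemma times_differentiable_has_real_derivative:
  fixes g :: "real \<Rightarrow> real"
  assumes "times_differentiable n g" "j < n" "0 < t"
  shows "(nth_deriv j g has_real_derivative nth_deriv (Suc j) g t) (at t)"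
  using times_differentiable_has_vector_derivative[OF assms(1,2), of t] assms(3)
  by (simp add: has_real_derivative_iff_has_vector_derivative at_within_interior[of t "{0..}"])

lemma periodicD: "periodic \<tau> x \<Longrightarrow> 0 \<le> t \<Longrightarrow> x (t + \<tau>) = x t"
  by (simp add: periodic_def)

lemma periodic_multiple:
  assumes "periodic \<tau> x" "0 \<le> \<tau>"
  shows "periodic (real k * \<tau>) x"
proof (induction k)
  case (Suc k)
  show ?case
    unfolding periodic_def
  proof (intro allI impI)
    fix t :: real assume t: "0 \<le> t"
    have "x (t + real (Suc k) * \<tau>) = x ((t + real k * \<tau>) + \<tau>)"
      by (simp add: algebra_simps)
    also have "\<dots> = x t"
      using assms t Suc by (simp add: periodic_def)
    finally show "x (t + real (Suc k) * \<tau>) = x t" .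
  qed
qed (simp add: periodic_def)

lemma periodic_nth_deriv:
  assumes g: "times_differentiable n g" and per: "periodic \<tau> g" and \<tau>: "0 \<le> \<tau>" and "j \<le> n"
  shows "periodic \<tau> (nth_deriv j g)"
  using \<open>j \<le> n\<close>
proof (induction j)
  case (Suc j)
  have IH: "nth_deriv j g (t + \<tau>) = nth_deriv j g t" if "0 \<le> t" for t
    using Suc that by (simp add: periodic_def)
  show ?case
    unfolding periodic_def
  proof (intro allI impI)
    fix t :: real assume t: "0 \<le> t"
    \<comment> \<open>At \<open>t = 0\<close> a one-sided derivative must be compared with a
      two-sided one at \<open>\<tau>\<close>. Restricting the latter to the shifted half-line lets
      the chain rule pull it back to a derivative within \<open>{0..}\<close>.\<close>
    have "(nth_deriv j g has_vector_derivative nth_deriv (Suc j) g (t + \<tau>))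
        (at (t + \<tau>) within (\<lambda>s. s + \<tau>) ` {0..})"
      by (rule has_vector_derivative_within_subset
          [OF times_differentiable_has_vector_derivative[OF g, of j "t + \<tau>"]])
        (use Suc.prems t \<tau> in auto)
    then have "(nth_deriv j g \<circ> (\<lambda>s. s + \<tau>) has_vector_derivative
        1 *\<^sub>R nth_deriv (Suc j) g (t + \<tau>)) (at t within {0..})"
      by (intro vector_diff_chain_within) (auto intro!: derivative_eq_intros)
    then have "(nth_deriv j g has_vector_derivative 1 *\<^sub>R nth_deriv (Suc j) g (t + \<tau>))
        (at t within {0..})"
      by (rule has_vector_derivative_transform[rotated 2]) (use IH t in auto)
    then have "(nth_deriv j g has_vector_derivative nth_deriv (Suc j) g (t + \<tau>))
        (at t within {0..})"
      by simp
    moreover have "(nth_deriv j g has_vector_derivative nth_deriv (Suc j) g t) (at t within {0..})"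
      using times_differentiable_has_vector_derivative[OF g, of j t] Suc.prems t by simp
    ultimately show "nth_deriv (Suc j) g (t + \<tau>) = nth_deriv (Suc j) g t"
      using at_within_atLeast_neq_bot[OF t] vector_derivative_unique_within by blast
  qed
qed (use per in simp)

lemma periodic_eq_on_period:
  assumes per: "periodic \<tau> x" and \<tau>: "0 < \<tau>" and "0 \<le> t"
  obtains s where "s \<in> {0..\<tau>}" "x t = x s"
proof -
  define k where "k = nat \<lfloor>t / \<tau>\<rfloor>"
  have k: "real k = of_int \<lfloor>t / \<tau>\<rfloor>"
    using assms by (simp add: k_def)
  have "real k \<le> t / \<tau>" "t / \<tau> < real k + 1"
    unfolding k by linarith+
  then have "t - real k * \<tau> \<in> {0..\<tau>}"
    using \<tau> by (simp add: field_simps)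
  moreover from this have "x t = x (t - real k * \<tau>)"
    using periodicD[OF periodic_multiple[OF per, of k], of "t - real k * \<tau>"] \<tau> by simp
  ultimately show ?thesis
    by (rule that)
qed

text \<open>Injectivity of the transform gives zero on one period, and periodicity spreads it over
  the half-line.\<close>

lemma periodic_zero_power_transform:
  assumes "periodic S g" "0 < S" "continuous_on {0..} g" "b < 0"
    and "\<And>t. 0 < t \<Longrightarrow> power_transform S g b t = 0" and "0 \<le> t"
  shows "g t = 0"
proof -
  have "continuous_on {0..S} g"
    using assms(3) by (rule continuous_on_subset) auto
  moreover obtain s where "s \<in> {0..S}" "g t = g s"
    using periodic_eq_on_period[OF assms(1,2,6)] .
  ultimately show ?thesis
    using power_transform_eq_0_imp_eq_0[of S g b s] assms by simp
qed

lemma constant_on_atLeastD: "g constant_on {0::real..} \<Longrightarrow> 0 \<le> t \<Longrightarrow> g t = g 0"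
  unfolding constant_on_def by force

text \<open>Such a function is affine, and equal values at 0 and \<open>\<tau>\<close> force the
  slope to be 0.\<close>

lemma periodic_constant_derivative:
  fixes g :: "real \<Rightarrow> real"
  assumes per: "periodic \<tau> g" and \<tau>: "0 < \<tau>"
    and der: "\<And>t. 0 \<le> t \<Longrightarrow> (g has_vector_derivative c) (at t within {0..})"
  shows "g constant_on {0..}"
proof -
  have "\<exists>k. \<forall>t\<in>{0..}. g t - c * t = k"
  proof (rule has_derivative_zero_constant)
    fix t :: real assume "t \<in> {0..}"
    then have "(g has_real_derivative c) (at t within {0..})"
      using der by (simp add: has_real_derivative_iff_has_vector_derivative)
    then have "((\<lambda>t. g t - c * t) has_real_derivative 0) (at t within {0..})"
      by (auto intro!: derivative_eq_intros)
    then show "((\<lambda>t. g t - c * t) has_derivative (\<lambda>h. 0)) (at t within {0..})"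
      by (simp add: has_field_derivative_def lambda_zero)
  qed simp
  then obtain k where k: "\<And>t. 0 \<le> t \<Longrightarrow> g t = k + c * t"
    by (force simp: algebra_simps)
  have "k + c * \<tau> = k + c * 0"
    using periodicD[OF per, of 0] k[of 0] k[of \<tau>] \<tau> by simp
  then have "c = 0"
    using \<tau> by simp
  then show ?thesis
    using k by (auto simp: constant_on_def)
qed

text \<open>Descent from order \<open>n\<close> to order 0: each lower derivative is again periodic
  and has a constant derivative, hence is itself constant.\<close>

lemma periodic_nth_deriv_zero_imp_constant:
  fixes g :: "real \<Rightarrow> real"
  assumes g: "times_differentiable n g" and per: "periodic \<tau> g" and \<tau>: "0 < \<tau>"
    and zero: "\<And>t. 0 \<le> t \<Longrightarrow> nth_deriv n g t = 0"
  shows "g constant_on {0..}"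
proof -
  have "nth_deriv 0 g constant_on {0..}"
  proof (rule inc_induct[of 0 n])
    show "nth_deriv n g constant_on {0..}"
      using zero by (auto simp: constant_on_def)
    fix j assume j: "j < n" and "nth_deriv (Suc j) g constant_on {0..}"
    then obtain c where "\<And>t. 0 \<le> t \<Longrightarrow> nth_deriv (Suc j) g t = c"
      by (auto simp: constant_on_def)
    then have "(nth_deriv j g has_vector_derivative c) (at t within {0..})" if "0 \<le> t" for t
      using times_differentiable_has_vector_derivative[OF g j that] that by simp
    then show "nth_deriv j g constant_on {0..}"
      using periodic_constant_derivative periodic_nth_deriv[OF g per] j \<tau>
      by (metis less_imp_le)
  qed simp
  then show ?thesis by simp
qed

section \<open>The Riemann-Liouville and Caputo derivatives\<close>

text \<open>Non-integrality of \<open>\<beta>\<close> makes the upper bound strict. The kernel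
  exponent \<open>deriv_order \<beta> - \<beta> - 1\<close> therefore lies strictly between -1 and
  0, and the Gamma factor is positive.\<close>

lemma deriv_order_bounds:
  assumes "0 < \<beta>" "\<beta> \<notin> \<nat>"
  shows "real (deriv_order \<beta>) - \<beta> \<in> {0<..<1}"
proof -
  have "real (deriv_order \<beta>) = of_int \<lfloor>\<beta>\<rfloor> + 1"
    using assms by (simp add: deriv_order_def)
  moreover have "of_int \<lfloor>\<beta>\<rfloor> \<noteq> \<beta>"
  proof
    assume "of_int \<lfloor>\<beta>\<rfloor> = \<beta>"
    moreover have "real (nat \<lfloor>\<beta>\<rfloor>) = of_int \<lfloor>\<beta>\<rfloor>"
      using assms(1) by simp
    ultimately show False
      using assms(2) of_nat_in_Nats by metis
  qed
  ultimately show ?thesis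
    using of_int_floor_le[of \<beta>] floor_less_cancel[of \<beta> "\<beta> + 1"]
    by (simp add: order_less_le) linarith
qed

text \<open>Splitting at \<open>S\<close> separates the first period from the rest. Shifting the
  rest back by \<open>S\<close> turns it, by periodicity, into the integral up to
  \<open>t\<close>.\<close>

lemma convolution_period_difference:
  fixes g :: "real \<Rightarrow> real"
  assumes per: "periodic S g" and S: "0 < S" and t: "0 \<le> t"
    and int: "\<And>t. 0 \<le> t \<Longrightarrow> (\<lambda>s. (t - s) powr b * g s) integrable_on {0..t}"
  shows "integral {0..t + S} (\<lambda>s. (t + S - s) powr b * g s)
    = power_transform S g b t + integral {0..t} (\<lambda>s. (t - s) powr b * g s)"
proof -
  have "integral {0..t + S} (\<lambda>s. (t + S - s) powr b * g s)
    = power_transform S g b t + integral {S..t + S} (\<lambda>s. (t + S - s) powr b * g s)"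
    unfolding power_transform_def
    using Henstock_Kurzweil_Integration.integral_combine[OF _ _ int[of "t + S"], of S] S t by simp
  also have "integral {S..t + S} (\<lambda>s. (t + S - s) powr b * g s)
      = integral {0..t} (\<lambda>s. (t + S - (s + S)) powr b * g (s + S))"
    using integral_shift_real_ivl[of S S "t + S" "\<lambda>s. (t + S - s) powr b * g s"] by simp
  also have "\<dots> = integral {0..t} (\<lambda>s. (t - s) powr b * g s)"
    by (rule integral_cong) (use periodicD[OF per] in auto)
  finally show ?thesis .
qed

text \<open>The fractional integral \<open>J\<close> changes over a period by a power transform of
  \<open>g\<close>. Differentiating this \<open>n\<close> times and using periodicity of the
  fractional derivative makes a transform of lower exponent vanish. Nonzero constants are excluded
  too.\<close>

lemma Riemann_Liouville_periodic_imp_zero: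
  assumes \<beta>: "0 < \<beta>" "\<beta> \<notin> \<nat>" and S: "0 < S" and per: "periodic S g"
    and cont: "continuous_on {0..} g"
    and ex: "frac_deriv_exists Riemann_Liouville \<beta> g"
    and D: "periodic S (frac_deriv Riemann_Liouville \<beta> g)" and t: "0 \<le> t"
  shows "g t = 0"
proof -
  define n where "n = deriv_order \<beta>"
  define b where "b = real n - \<beta> - 1"
  define J where "J = (\<lambda>u. integral {0..u} (\<lambda>s. (u - s) powr b * g s))"
  \<comment> \<open>The falling factorial collected by differentiating a power with exponent
    \<open>b\<close> repeatedly. None of its factors is 0, since \<open>b < 0\<close>.\<close>
  define c where "c = (\<lambda>j. \<Prod>i<j. b - real i)"
  have b: "-1 < b" "b < 0"
    using deriv_order_bounds[OF \<beta>] by (auto simp: b_def n_def)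
  have int: "(\<lambda>s. (t - s) powr b * g s) integrable_on {0..t}" if "0 \<le> t" for t
    using ex that by (simp add: RL_kernel_def[abs_def] b_def n_def)
  have J: "times_differentiable n J"
    using ex by (simp add: RL_kernel_def[abs_def] b_def n_def J_def)
  have g: "continuous_on {0..S} g"
    using cont by (rule continuous_on_subset) auto
  have diff: "nth_deriv j J (t + S) - nth_deriv j J t = c j * power_transform S g (b - real j) t"
    if "j \<le> n" "0 < t" for j t
    using that
  proof (induction j arbitrary: t)
    case 0
    then show ?case
      using convolution_period_difference[OF per S _ int, of t] by (simp add: J_def c_def)
  next
    case (Suc j)
    have "((\<lambda>t. nth_deriv j J (t + S) - nth_deriv j J t) has_real_derivative
        nth_deriv (Suc j) J (t + S) - nth_deriv (Suc j) J t) (at t)"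
    proof (rule DERIV_diff)
      have "(nth_deriv j J has_real_derivative nth_deriv (Suc j) J (t + S)) (at (t + S))"
        using times_differentiable_has_real_derivative[OF J, of j "t + S"] Suc.prems S by simp
      then show "((\<lambda>t. nth_deriv j J (t + S)) has_real_derivative
          nth_deriv (Suc j) J (t + S)) (at t)"
        by (simp add: DERIV_shift)
      show "(nth_deriv j J has_real_derivative nth_deriv (Suc j) J t) (at t)"
        using times_differentiable_has_real_derivative[OF J] Suc.prems by simp
    qed
    then have "((\<lambda>t. c j * power_transform S g (b - real j) t) has_real_derivative
        nth_deriv (Suc j) J (t + S) - nth_deriv (Suc j) J t) (at t)"
      by (rule has_field_derivative_transform_within_open[where S = "{0<..}"])
        (use Suc in auto)
    moreover have "((\<lambda>t. c j * power_transform S g (b - real j) t) has_real_derivative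
        c j * ((b - real j) * power_transform S g (b - real j - 1) t)) (at t)"
      by (intro DERIV_cmult has_real_derivative_power_transform[OF g Suc.prems(2)])
    ultimately have "nth_deriv (Suc j) J (t + S) - nth_deriv (Suc j) J t
        = c j * ((b - real j) * power_transform S g (b - real j - 1) t)"
      by (rule DERIV_unique)
    then show ?case
      by (simp add: c_def algebra_simps)
  qed
  have "Gamma (real n - \<beta>) > 0"
    using deriv_order_bounds[OF \<beta>] by (simp add: n_def)
  then have "nth_deriv n J (t + S) = nth_deriv n J t" if "0 \<le> t" for t
    using periodicD[OF D that] by (simp add: RL_kernel_def[abs_def] b_def n_def J_def)
  \<comment> \<open>The exponent \<open>b - real n\<close> equals \<open>- \<beta> - 1\<close>, the
    one that also appears in the Grunwald-Letnikov case.\<close>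
  then have "c n * power_transform S g (b - real n) t = 0" if "0 < t" for t
    using diff[of n t] that by simp
  moreover have "c n \<noteq> 0"
    using b by (simp add: c_def)
  ultimately show ?thesis
    using periodic_zero_power_transform[OF per S cont _ _ t, of "b - real n"] b by simp
qed

text \<open>Here the kernel acts on the top derivative, so it is this derivative that is forced to
  vanish. Constants survive, and periodicity rules out other polynomials.\<close>

lemma Caputo_periodic_imp_constant:
  assumes \<beta>: "0 < \<beta>" "\<beta> \<notin> \<nat>" and S: "0 < S" and per: "periodic S g"
    and g: "times_differentiable (deriv_order \<beta>) g"
    and cont: "continuous_on {0..} (nth_deriv (deriv_order \<beta>) g)"
    and ex: "frac_deriv_exists Caputo \<beta> g"
    and D: "periodic S (frac_deriv Caputo \<beta> g)"
  shows "g constant_on {0..}"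
proof -
  define n where "n = deriv_order \<beta>"
  define b where "b = real n - \<beta> - 1"
  have b: "b < 0" and Gamma: "Gamma (real n - \<beta>) > 0"
    using deriv_order_bounds[OF \<beta>] by (auto simp: b_def n_def)
  have per': "periodic S (nth_deriv n g)"
    using periodic_nth_deriv[OF g per] S by (simp add: n_def)
  have int: "(\<lambda>s. (t - s) powr b * nth_deriv n g s) integrable_on {0..t}" if "0 \<le> t" for t
    using ex that by (simp add: Caputo_kernel_def[abs_def] b_def n_def)
  have "power_transform S (nth_deriv n g) b t = 0" if "0 < t" for t
    using convolution_period_difference[OF per' S _ int, of t] periodicD[OF D, of t] that Gamma
    by (simp add: Caputo_kernel_def[abs_def] b_def n_def)
  then have "nth_deriv n g t = 0" if "0 \<le> t" for t
    using periodic_zero_power_transform[OF per' S _ b _ that] cont by (simp add: n_def)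
  then show ?thesis
    using periodic_nth_deriv_zero_imp_constant[OF g per S] by (simp add: n_def)
qed

section \<open>Riemann sums and the Grunwald-Letnikov derivative\<close>

lemma integral_uniform_partition:
  fixes \<phi> :: "real \<Rightarrow> real"
  assumes "continuous_on {0..real n * h} \<phi>" "0 \<le> h"
  shows "integral {0..real n * h} \<phi> = (\<Sum>i<n. integral {real i * h..real (Suc i) * h} \<phi>)"
  using assms(1)
proof (induction n)
  case (Suc n)
  have le: "real n * h \<le> real (Suc n) * h"
    using assms(2) by (intro mult_right_mono) auto
  have "continuous_on {0..real n * h} \<phi>"
    using Suc.prems by (rule continuous_on_subset) (use le in auto)
  moreover have "integral {0..real n * h} \<phi> + integral {real n * h..real (Suc n) * h} \<phi>
      = integral {0..real (Suc n) * h} \<phi>"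
    using assms(2) le
    by (intro Henstock_Kurzweil_Integration.integral_combine integrable_continuous_real Suc.prems) auto
  ultimately show ?case
    using Suc.IH by simp
qed simp

lemma left_Riemann_sum_tendsto:
  fixes \<phi> :: "real \<Rightarrow> real"
  assumes \<phi>: "continuous_on {0..S} \<phi>" and S: "0 < S"
  shows "(\<lambda>N. S / real N * (\<Sum>i<N. \<phi> (real i * (S / real N)))) \<longlonglongrightarrow> integral {0..S} \<phi>"
proof (rule tendstoI)
  fix e :: real assume e: "0 < e"
  \<comment> \<open>With an error of at most \<open>\<eta> * h\<close> on each of the
    \<open>N\<close> cells of width \<open>h = S / N\<close>, the total is at most
    \<open>\<eta> * S = e / 2\<close>.\<close>
  define \<eta> where "\<eta> = e / (2 * S)"
  have \<eta>: "\<eta> > 0"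
    using e S by (simp add: \<eta>_def)
  obtain \<delta> where \<delta>: "0 < \<delta>"
    and unif: "\<And>x y. x \<in> {0..S} \<Longrightarrow> y \<in> {0..S} \<Longrightarrow> dist y x < \<delta> \<Longrightarrow> dist (\<phi> y) (\<phi> x) < \<eta>"
    using compact_uniformly_continuous[OF \<phi>] \<eta> unfolding uniformly_continuous_on_def
    by (metis compact_Icc)
  have "((\<lambda>N. S / real N) \<longlongrightarrow> 0) sequentially"
    by (rule lim_const_over_n)
  then have "\<forall>\<^sub>F N in sequentially. S / real N < \<delta>"
    using \<delta> by (rule order_tendstoD)
  then show "\<forall>\<^sub>F N in sequentially.
      dist (S / real N * (\<Sum>i<N. \<phi> (real i * (S / real N)))) (integral {0..S} \<phi>) < e"
    using eventually_gt_at_top[of 0]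
  proof eventually_elim
    case (elim N)
    define h where "h = S / real N"
    have h: "0 < h" "h < \<delta>" and Nh: "real N * h = S"
      using elim S by (auto simp: h_def)
    have piece: "\<bar>h * \<phi> (real i * h) - integral {real i * h..real (Suc i) * h} \<phi>\<bar> \<le> \<eta> * h"
      if "i < N" for i
    proof -
      have "real (Suc i) * h \<le> real N * h"
        using that h by (intro mult_right_mono) auto
      then have sub: "{real i * h..real (Suc i) * h} \<subseteq> {0..S}"
        using h Nh by auto
      have len: "real (Suc i) * h - real i * h = h"
        by (simp add: algebra_simps)
      have cont: "continuous_on {real i * h..real (Suc i) * h} \<phi>"
        using \<phi> sub by (rule continuous_on_subset)
      have "norm (integral {real i * h..real (Suc i) * h} (\<lambda>s. \<phi> (real i * h) - \<phi> s))
          \<le> \<eta> * (real (Suc i) * h - real i * h)"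
      proof (rule integral_bound)
        fix s assume s: "s \<in> {real i * h..real (Suc i) * h}"
        then have "dist (real i * h) s < \<delta>"
          using h len by (auto simp: dist_real_def)
        moreover have "real i * h \<in> {0..S}"
          using sub len h by auto
        ultimately show "norm (\<phi> (real i * h) - \<phi> s) \<le> \<eta>"
          using unif[of s "real i * h"] s sub by (auto simp: dist_real_def)
      qed (use len h cont in \<open>auto intro!: continuous_on_diff continuous_on_const simp del: of_nat_Suc\<close>)
      also have "integral {real i * h..real (Suc i) * h} (\<lambda>s. \<phi> (real i * h) - \<phi> s)
          = h * \<phi> (real i * h) - integral {real i * h..real (Suc i) * h} \<phi>"
        using len h integrable_continuous_real[OF cont]
        by (subst integral_diff) auto
      finally show ?thesis
        using len by simp
    qed
    have "\<bar>h * (\<Sum>i<N. \<phi> (real i * h)) - integral {0..S} \<phi>\<bar>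
        = \<bar>\<Sum>i<N. h * \<phi> (real i * h) - integral {real i * h..real (Suc i) * h} \<phi>\<bar>"
      using integral_uniform_partition[of N h \<phi>] \<phi> h Nh
      by (simp add: sum_distrib_left sum_subtractf)
    also have "\<dots> \<le> (\<Sum>i<N. \<eta> * h)"
      by (rule order_trans[OF sum_abs sum_mono]) (use piece in auto)
    also have "\<dots> = \<eta> * S"
      using Nh by (simp add: mult.left_commute)
    also have "\<dots> < e"
      using e S by (simp add: \<eta>_def)
    finally show ?case
      by (simp add: dist_real_def h_def)
  qed
qed

text \<open>Split each weight as \<open>(w N i - c) + c\<close>. The first part contributes a null
  sequence since \<open>\<phi>\<close> is bounded and the weights converge uniformly in
  \<open>i\<close>; the second is an ordinary Riemann sum.\<close>

lemma weighted_left_Riemann_sum_tendsto: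
  fixes \<phi> :: "real \<Rightarrow> real"
  assumes \<phi>: "continuous_on {0..S} \<phi>" and S: "0 < S"
    and w: "\<And>\<epsilon>. 0 < \<epsilon> \<Longrightarrow> \<forall>\<^sub>F N in sequentially. \<forall>i<N. \<bar>w N i - c\<bar> \<le> \<epsilon>"
  shows "(\<lambda>N. S / real N * (\<Sum>i<N. w N i * \<phi> (real i * (S / real N))))
    \<longlonglongrightarrow> c * integral {0..S} \<phi>"
proof -
  obtain B where B: "0 < B" "\<And>s. s \<in> {0..S} \<Longrightarrow> \<bar>\<phi> s\<bar> \<le> B"
    using compact_imp_bounded[OF compact_continuous_image[OF \<phi>]] unfolding bounded_pos by auto
  have "(\<lambda>N. S / real N * (\<Sum>i<N. (w N i - c) * \<phi> (real i * (S / real N)))) \<longlonglongrightarrow> 0"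
  proof (rule tendstoI)
    fix e :: real assume e: "0 < e"
    define \<epsilon> where "\<epsilon> = e / (2 * (B * S))"
    have \<epsilon>: "\<epsilon> > 0"
      using e S B by (simp add: \<epsilon>_def)
    show "\<forall>\<^sub>F N in sequentially.
        dist (S / real N * (\<Sum>i<N. (w N i - c) * \<phi> (real i * (S / real N)))) 0 < e"
      using w[OF \<epsilon>] eventually_gt_at_top[of 0]
    proof eventually_elim
      case (elim N)
      have "\<bar>\<Sum>i<N. (w N i - c) * \<phi> (real i * (S / real N))\<bar> \<le> (\<Sum>i<N. \<epsilon> * B)"
      proof (rule order_trans[OF sum_abs sum_mono])
        fix i assume i: "i \<in> {..<N}"
        then have "real i * (S / real N) \<in> {0..S}"
          using S by (auto simp: field_simps)
        then show "\<bar>(w N i - c) * \<phi> (real i * (S / real N))\<bar> \<le> \<epsilon> * B"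
          unfolding abs_mult using elim i B by (intro mult_mono) auto
      qed
      then have "S / real N * \<bar>\<Sum>i<N. (w N i - c) * \<phi> (real i * (S / real N))\<bar>
          \<le> S / real N * (real N * (\<epsilon> * B))"
        using S by (intro mult_left_mono) auto
      also have "\<dots> = e / 2"
        using S B elim by (simp add: \<epsilon>_def)
      also have "\<dots> < e"
        using e by simp
      finally show ?case
        using S by (simp add: dist_real_def abs_mult)
    qed
  qed
  from tendsto_add[OF this tendsto_mult_left[OF left_Riemann_sum_tendsto[OF \<phi> S], of c]]
  show ?thesis
    by (simp add: left_diff_distrib sum_subtractf right_diff_distrib
        sum_distrib_left[of c, symmetric] mult.assoc mult.left_commute[of c])
qed

text \<open>The signed binomial coefficients, normalised by their order of decay.\<close>

definition GL_weight :: "real \<Rightarrow> nat \<Rightarrow> real" where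
  "GL_weight \<beta> r = (-1) ^ r * (\<beta> gchoose r) * real r powr (\<beta> + 1)"

lemma GL_weight_tendsto: "GL_weight \<beta> \<longlonglongrightarrow> inverse (Gamma (- \<beta>))"
proof (rule Lim_transform_eventually[OF gbinomial_asymptotic[of \<beta>]])
  show "\<forall>\<^sub>F n in sequentially.
      (\<beta> gchoose n) / ((-1) ^ n / exp ((\<beta> + 1) * of_real (ln (real n)))) = GL_weight \<beta> n"
    \<comment> \<open>Index 0 must be avoided: there \<open>GL_weight\<close> is 0 because
      \<open>0 powr (\<beta> + 1) = 0\<close>, whereas the quotient is 1.\<close>
    using eventually_gt_at_top[of 0]
    by eventually_elim (auto simp: GL_weight_def powr_def uminus_power_if)
qed

text \<open>Since \<open>h\<close> divides both \<open>t\<close> and \<open>S\<close>, the two sums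
  run over one grid. By periodicity the terms with index up to \<open>K\<close> cancel, and the
  other \<open>M\<close> terms sample \<open>g\<close> at the left end points of the cells of the
  first period.\<close>

lemma GL_quotient_period_difference:
  assumes per: "periodic S g" and h: "0 < h" and S: "S = real M * h" and t: "t = real K * h"
  shows "GL_quotient \<beta> g (t + S) h - GL_quotient \<beta> g t h
    = h * (\<Sum>i<M. GL_weight \<beta> (K + M - i) * ((t + S - real i * h) powr (- \<beta> - 1) * g (real i * h)))"
proof -
  define L where "L = K + M"
  define c where "c = (\<lambda>r. (-1) ^ r * (\<beta> gchoose r))"
  have tS: "t + S = real L * h"
    by (simp add: S t L_def algebra_simps)
  have floors: "nat \<lfloor>t / h\<rfloor> = K" "nat \<lfloor>(t + S) / h\<rfloor> = L"
    unfolding tS using h by (simp_all add: t)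
  have "(\<Sum>r=0..K. c r * g (t - real r * h)) = (\<Sum>r=0..K. c r * g (t + S - real r * h))"
  proof (rule sum.cong)
    fix r assume "r \<in> {0..K}"
    then have "0 \<le> t - real r * h"
      using h by (simp add: t mult_right_mono)
    from periodicD[OF per this] show "c r * g (t - real r * h) = c r * g (t + S - real r * h)"
      by (simp add: algebra_simps)
  qed simp
  moreover have "(\<Sum>r=0..L. c r * g (t + S - real r * h))
      = (\<Sum>r=0..K. c r * g (t + S - real r * h)) + (\<Sum>r=Suc K..L. c r * g (t + S - real r * h))"
    by (rule sum.ub_add_nat[of 0 K _ M, folded L_def, simplified])
  moreover have "GL_quotient \<beta> g u h
      = h powr - \<beta> * (\<Sum>r=0..nat \<lfloor>u / h\<rfloor>. c r * g (u - real r * h))" for u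
    by (simp add: GL_quotient_def c_def)
  ultimately have "GL_quotient \<beta> g (t + S) h - GL_quotient \<beta> g t h
      = h powr - \<beta> * (\<Sum>r=Suc K..L. c r * g (t + S - real r * h))"
    by (simp add: floors right_diff_distrib[symmetric])
  \<comment> \<open>Counting from the origin, \<open>i = L - r\<close>, turns the delayed arguments
    into the grid points \<open>i * h\<close>.\<close>
  also have "(\<Sum>r=Suc K..L. c r * g (t + S - real r * h)) = (\<Sum>i<M. c (L - i) * g (real i * h))"
  proof (rule sum.reindex_bij_witness[of _ "\<lambda>i. L - i" "\<lambda>r. L - r"])
    fix r assume "r \<in> {Suc K..L}"
    then show "c (L - (L - r)) * g (real (L - r) * h) = c r * g (t + S - real r * h)"
      by (simp add: tS of_nat_diff left_diff_distrib)
  qed (auto simp: L_def)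
  also have "h powr - \<beta> * \<dots> = (\<Sum>i<M. h * (GL_weight \<beta> (L - i)
      * ((t + S - real i * h) powr (- \<beta> - 1) * g (real i * h))))"
    unfolding sum_distrib_left
  proof (rule sum.cong)
    fix i assume "i \<in> {..<M}"
    then have i: "i < L" by (simp add: L_def)
    define r where "r = real (L - i)"
    have r: "r > 0" "t + S - real i * h = r * h"
      using i unfolding tS by (auto simp: r_def of_nat_diff algebra_simps)
    have "r powr (\<beta> + 1) * r powr (- \<beta> - 1) = 1"
      using r(1) by (simp add: powr_add[symmetric])
    moreover have "h * h powr (- \<beta> - 1) = h powr - \<beta>"
      using h by (simp add: powr_diff)
    \<comment> \<open>The power of \<open>r\<close> normalising the weight cancels against the one
      in \<open>(r * h) powr (- \<beta> - 1)\<close>. One factor \<open>h\<close> is left over as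
      the mesh of the Riemann sum.\<close>
    ultimately have "h * (r powr (\<beta> + 1) * (r * h) powr (- \<beta> - 1)) = h powr - \<beta>"
      using r(1) h by (simp add: powr_mult mult.left_commute mult.assoc[symmetric])
    then show "h powr - \<beta> * (c (L - i) * g (real i * h)) = h * (GL_weight \<beta> (L - i)
        * ((t + S - real i * h) powr (- \<beta> - 1) * g (real i * h)))"
      unfolding r(2) by (simp add: GL_weight_def c_def r_def[symmetric])
  qed simp
  finally show ?thesis
    by (simp add: sum_distrib_left L_def)
qed

text \<open>For \<open>t = S a / b\<close> the steps \<open>h = S / (b N)\<close> divide both \<open>t\<close> and \<open>S\<close>, so that the difference of the
  quotients at \<open>t + S\<close> and \<open>t\<close> is a weighted Riemann sum with weights tending to \<open>1 / Gamma (- \<beta>)\<close>.\<close>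

lemma GL_periodic_imp_power_transform_zero_rational:
  assumes \<beta>: "0 < \<beta>" "\<beta> \<notin> \<nat>" and S: "0 < S" and per: "periodic S g"
    and cont: "continuous_on {0..S} g"
    and ex: "frac_deriv_exists Grunwald_Letnikov \<beta> g"
    and D: "periodic S (frac_deriv Grunwald_Letnikov \<beta> g)"
    and "0 < a" "0 < b" and t: "t = S * real a / real b"
  shows "power_transform S g (- \<beta> - 1) t = 0"
proof -
  have t0: "0 < t"
    using assms by simp
  have lim: "(GL_quotient \<beta> g u \<longlongrightarrow> frac_deriv Grunwald_Letnikov \<beta> g u) (at_right 0)"
    if u: "0 \<le> u" for u
  proof -
    obtain l where l: "(GL_quotient \<beta> g u \<longlongrightarrow> l) (at_right 0)"
      using ex u by auto
    then have "frac_deriv Grunwald_Letnikov \<beta> g u = l"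
      by (simp add: tendsto_Lim)
    with l show ?thesis by simp
  qed
  have diff: "((\<lambda>h. GL_quotient \<beta> g (t + S) h - GL_quotient \<beta> g t h) \<longlongrightarrow> 0) (at_right 0)"
    using tendsto_diff[OF lim[of "t + S"] lim[of t]] periodicD[OF D, of t] t0 S by simp
  have bN: "filterlim (\<lambda>N. b * N) at_top sequentially"
    using \<open>0 < b\<close> by (simp add: mult_nat_left_at_top)
  define h where "h = (\<lambda>N. S / real (b * N))"
  have "h \<longlonglongrightarrow> 0"
    unfolding h_def using filterlim_compose[OF lim_const_over_n bN] .
  moreover have "\<forall>\<^sub>F N in sequentially. h N > 0"
    using eventually_gt_at_top[of 0] by eventually_elim (use S \<open>0 < b\<close> in \<open>auto simp: h_def\<close>)
  ultimately have "filterlim h (at_right 0) sequentially"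
    by (auto simp: filterlim_at elim: eventually_mono)
  from filterlim_compose[OF diff this]
  have 1: "(\<lambda>N. GL_quotient \<beta> g (t + S) (h N) - GL_quotient \<beta> g t (h N)) \<longlonglongrightarrow> 0" .
  \<comment> \<open>For \<open>M = b * N\<close> the index is \<open>a * N + M - i\<close>, which
    matches \<open>K = a * N\<close>. The division defines the weights for every \<open>M\<close>,
    so the limit can be taken first and then restricted to multiples of \<open>b\<close>.\<close>
  define w where "w = (\<lambda>M i. GL_weight \<beta> (a * (M div b) + M - i))"
  define \<phi> where "\<phi> = (\<lambda>s. (t + S - s) powr (- \<beta> - 1) * g s)"
  have "(\<lambda>M. S / real M * (\<Sum>i<M. w M i * \<phi> (real i * (S / real M))))
      \<longlonglongrightarrow> inverse (Gamma (- \<beta>)) * integral {0..S} \<phi>"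
  proof (rule weighted_left_Riemann_sum_tendsto)
    show "continuous_on {0..S} \<phi>"
      unfolding \<phi>_def by (rule continuous_on_power_transform_integrand[OF cont t0])
    fix \<epsilon> :: real assume "0 < \<epsilon>"
    with GL_weight_tendsto[of \<beta>] have "\<forall>\<^sub>F r in sequentially. dist (GL_weight \<beta> r) (inverse (Gamma (- \<beta>))) < \<epsilon>"
      by (rule tendstoD)
    then obtain R where R: "\<And>r. R \<le> r \<Longrightarrow> \<bar>GL_weight \<beta> r - inverse (Gamma (- \<beta>))\<bar> < \<epsilon>"
      by (auto simp: eventually_sequentially dist_real_def)
    show "\<forall>\<^sub>F M in sequentially. \<forall>i<M. \<bar>w M i - inverse (Gamma (- \<beta>))\<bar> \<le> \<epsilon>"
      using eventually_ge_at_top[of "R * b"]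
    proof eventually_elim
      \<comment> \<open>For all \<open>i < M\<close> the index is at least
        \<open>a * (M div b)\<close>, hence at least \<open>R\<close>. Thus only late weights occur,
        uniformly in \<open>i\<close>; this rests on \<open>t > 0\<close>, that is, on
        \<open>a > 0\<close>.\<close>
      case (elim M)
      then have "R \<le> M div b"
        using \<open>0 < b\<close> by (simp add: less_eq_div_iff_mult_less_eq)
      then have "R \<le> a * (M div b)"
        using \<open>0 < a\<close> by (metis One_nat_def Suc_leI le_trans mult_le_mono1 nat_mult_1)
      then show ?case
        unfolding w_def by (intro allI impI less_imp_le R) linarith
    qed
  qed (rule S)
  from filterlim_compose[OF this bN]
  have "(\<lambda>N. h N * (\<Sum>i<b * N. w (b * N) i * \<phi> (real i * h N)))
      \<longlonglongrightarrow> inverse (Gamma (- \<beta>)) * integral {0..S} \<phi>"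
    by (simp add: h_def)
  moreover have "\<forall>\<^sub>F N in sequentially. h N * (\<Sum>i<b * N. w (b * N) i * \<phi> (real i * h N))
      = GL_quotient \<beta> g (t + S) (h N) - GL_quotient \<beta> g t (h N)"
    using eventually_gt_at_top[of 0]
  proof eventually_elim
    case (elim N)
    have h: "0 < h N" "S = real (b * N) * h N" "t = real (a * N) * h N"
      using elim \<open>0 < b\<close> S by (simp_all add: h_def t)
    have "b * N div b = N"
      using \<open>0 < b\<close> by simp
    with GL_quotient_period_difference[OF per h, of \<beta>] show ?case
      unfolding w_def \<phi>_def by (simp only:)
  qed
  ultimately have "(\<lambda>N. GL_quotient \<beta> g (t + S) (h N) - GL_quotient \<beta> g t (h N))
      \<longlonglongrightarrow> inverse (Gamma (- \<beta>)) * integral {0..S} \<phi>"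
    by (rule Lim_transform_eventually)
  from LIMSEQ_unique[OF this 1] have "inverse (Gamma (- \<beta>)) * integral {0..S} \<phi> = 0" .
  \<comment> \<open>\<open>Gamma\<close> takes the value 0 at its poles by convention, and
    \<open>\<beta> \<notin> \<nat>\<close> keeps \<open>- \<beta>\<close> away from them.\<close>
  moreover have "Gamma (- \<beta>) \<noteq> 0"
    using \<beta> by (auto simp: Gamma_eq_zero_iff elim!: nonpos_Ints_cases')
  ultimately show ?thesis
    by (simp add: power_transform_def \<phi>_def)
qed

text \<open>The transform is known to vanish at positive rational multiples of \<open>S\<close>.
  These are dense and the transform is continuous on the positive half-line, so it vanishes
  there.\<close>

lemma Grunwald_Letnikov_periodic_imp_zero:
  assumes \<beta>: "0 < \<beta>" "\<beta> \<notin> \<nat>" and S: "0 < S" and per: "periodic S g"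
    and cont: "continuous_on {0..} g"
    and ex: "frac_deriv_exists Grunwald_Letnikov \<beta> g"
    and D: "periodic S (frac_deriv Grunwald_Letnikov \<beta> g)" and "0 \<le> t"
  shows "g t = 0"
proof (rule periodic_zero_power_transform[OF per S cont _ _ \<open>0 \<le> t\<close>])
  fix t :: real assume t: "0 < t"
  have g: "continuous_on {0..S} g"
    using cont by (rule continuous_on_subset) auto
  define k where "k = (\<lambda>N::nat. nat \<lfloor>t * real N / S\<rfloor>)"
  \<comment> \<open>This rounds \<open>t\<close> down to a multiple of \<open>S / N\<close>, so
    \<open>u N\<close> is a rational multiple of \<open>S\<close> within \<open>S / N\<close> of
    \<open>t\<close>.\<close>
  define u where "u = (\<lambda>N. S * real (k N) / real N)"
  have "isCont (power_transform S g (- \<beta> - 1)) t"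
    using has_real_derivative_power_transform[OF g t] by (rule DERIV_isCont)
  moreover have "u \<longlonglongrightarrow> t"
  proof (rule tendsto_sandwich)
    have bounds: "t - S / real N \<le> u N \<and> u N \<le> t" if "0 < N" for N
    proof -
      have "real (k N) = of_int \<lfloor>t * real N / S\<rfloor>"
        using t S by (simp add: k_def)
      then have "t * real N / S - 1 \<le> real (k N)"
        "real (k N) \<le> t * real N / S"
        by linarith+
      then have "t * real N - S \<le> S * real (k N)"
        "S * real (k N) \<le> t * real N"
        using S by (simp_all add: field_simps)
      then have "(t * real N - S) / real N \<le> u N" "u N \<le> t * real N / real N"
        unfolding u_def by (metis divide_right_mono of_nat_0_le_iff)+
      then show ?thesis
        using that by (simp add: diff_divide_distrib)
    qed
    show "\<forall>\<^sub>F N in sequentially. t - S / real N \<le> u N"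
      "\<forall>\<^sub>F N in sequentially. u N \<le> t"
      using eventually_gt_at_top[of 0] by (eventually_elim, simp add: bounds)+
    show "(\<lambda>N. t - S / real N) \<longlonglongrightarrow> t"
      using tendsto_diff[OF tendsto_const lim_const_over_n] by simp
  qed simp
  ultimately have "(\<lambda>N. power_transform S g (- \<beta> - 1) (u N))
      \<longlonglongrightarrow> power_transform S g (- \<beta> - 1) t"
    by (rule isCont_tendsto_compose)
  moreover have "\<forall>\<^sub>F N in sequentially. power_transform S g (- \<beta> - 1) (u N) = 0"
  proof -
    have "\<forall>\<^sub>F N in sequentially. u N > 0"
      using \<open>u \<longlonglongrightarrow> t\<close> t by (rule order_tendstoD)
    then show ?thesis
    proof eventually_elim
      case (elim N)
      then have "0 < k N" "0 < N"
        by (auto simp: u_def intro!: Nat.gr0I)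
      then show ?case
        using GL_periodic_imp_power_transform_zero_rational[OF \<beta> S per g ex D] by (simp add: u_def)
    qed
  qed
  then have "(\<lambda>N. power_transform S g (- \<beta> - 1) (u N)) \<longlonglongrightarrow> 0"
    by (rule tendsto_eventually)
  ultimately show "power_transform S g (- \<beta> - 1) t = 0"
    by (rule LIMSEQ_unique)
qed (use \<beta> in simp)

section \<open>From single components to the system\<close>

lemma periodic_frac_deriv_imp_constant:
  assumes \<beta>: "0 < \<beta>" "\<beta> \<notin> \<nat>" and S: "0 < S" and per: "periodic S g"
    and g: "times_differentiable (deriv_order \<beta>) g"
    and cont: "continuous_on {0..} (nth_deriv (deriv_order \<beta>) g)"
    and ex: "frac_deriv_exists k \<beta> g" and D: "periodic S (frac_deriv k \<beta> g)"
  shows "g constant_on {0..}"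
proof -
  \<comment> \<open>\<open>deriv_order \<beta>\<close> is at least 1, so order 0 is among the
    differentiable ones.\<close>
  have "nth_deriv 0 g differentiable_on {0..}"
    using g unfolding times_differentiable_def by (simp add: deriv_order_def del: nth_deriv_0)
  then have g0: "continuous_on {0..} g"
    by (simp add: differentiable_imp_continuous_on)
  show ?thesis
  proof (cases k)
    case Riemann_Liouville
    then have "g t = 0" if "0 \<le> t" for t
      using Riemann_Liouville_periodic_imp_zero[OF \<beta> S per g0] ex D that by blast
    then show ?thesis by (auto simp: constant_on_def)
  next
    case Caputo
    then show ?thesis
      using Caputo_periodic_imp_constant[OF \<beta> S per g cont] ex D by blast
  next
    case Grunwald_Letnikov
    then have "g t = 0" if "0 \<le> t" for t
      using Grunwald_Letnikov_periodic_imp_zero[OF \<beta> S per g0] ex D that by blast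
    then show ?thesis by (auto simp: constant_on_def)
  qed
qed

theorem corollary2:
  fixes \<alpha> :: "real ^ 'p"
    and D :: "'p \<Rightarrow> frac_kind"
    and m k :: nat
    and f :: "real \<Rightarrow> (nat \<Rightarrow> real ^ 'p) \<Rightarrow> real ^ 'p"
    and T :: real
  assumes "\<And>i. 0 < \<alpha> $ i \<and> \<alpha> $ i \<notin> \<nat>"
    and "0 < T"
    and "1 \<le> k"
    and "\<And>y. y \<in> {..m} \<rightarrow>\<^sub>E UNIV \<Longrightarrow> periodic T (\<lambda>t. f t y)"
  shows "\<not> (\<exists>x. class_C (\<chi> i. deriv_order (\<alpha> $ i)) x \<and>
                is_solution D \<alpha> m f x \<and>
                periodic (real k * T) x \<and>
                \<not> x constant_on {0..})"
proof (clarify)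
  fix x
  assume C: "class_C (\<chi> i. deriv_order (\<alpha> $ i)) x" and sol: "is_solution D \<alpha> m f x"
    and per: "periodic (real k * T) x" and nonconst: "\<not> x constant_on {0..}"
  define S where "S = real k * T"
  have S: "0 < S"
    using assms by (simp add: S_def)
  define Y where "Y = (\<lambda>t. \<lambda>j\<in>{..m}. nth_deriv j x t)"
  have eq: "frac_deriv (D i) (\<alpha> $ i) (\<lambda>s. x s $ i) t = f t (Y t) $ i" if "0 \<le> t" for t i
  proof -
    have "(\<chi> i. frac_deriv (D i) (\<alpha> $ i) (\<lambda>s. x s $ i) t) = f t (Y t)"
      using sol that by (simp add: is_solution_def Y_def)
    then have "(\<chi> i. frac_deriv (D i) (\<alpha> $ i) (\<lambda>s. x s $ i) t) $ i = f t (Y t) $ i"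
      by simp
    then show ?thesis
      by simp
  qed
  have "Y (t + S) = Y t" if "0 \<le> t" for t
  proof -
    have "times_differentiable m x"
      using sol by (simp add: is_solution_def)
    then have "nth_deriv j x (t + S) = nth_deriv j x t" if "j \<le> m" for j
      using periodicD[OF periodic_nth_deriv[OF _ per _ that]] S \<open>0 \<le> t\<close> by (simp add: S_def)
    then show ?thesis
      \<comment> \<open>Beyond \<open>m\<close> both functions are \<open>undefined\<close>, so
        agreement up to \<open>m\<close> is equality.\<close>
      by (auto simp: Y_def restrict_def)
  qed
  moreover have "f (t + S) (Y t) = f t (Y t)" if "0 \<le> t" for t
  proof -
    \<comment> \<open>Periodicity of \<open>f\<close> applies with the second argument frozen at
      \<open>Y t\<close>. Together with \<open>Y (t + S) = Y t\<close> it makes the right-hand side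
      periodic along the solution.\<close>
    have "periodic S (\<lambda>t. f t y)" if "y \<in> {..m} \<rightarrow>\<^sub>E UNIV" for y
      unfolding S_def using assms(2) by (intro periodic_multiple assms(4) that) simp
    from periodicD[OF this \<open>0 \<le> t\<close>] show ?thesis
      by (simp add: Y_def)
  qed
  ultimately have D: "periodic S (frac_deriv (D i) (\<alpha> $ i) (\<lambda>s. x s $ i))" for i
    using S by (simp add: periodic_def eq)
  have const: "(\<lambda>t. x t $ i) constant_on {0..}" for i
  proof (rule periodic_frac_deriv_imp_constant[OF _ _ S _ _ _ _ D])
    show "periodic S (\<lambda>t. x t $ i)"
      using per by (simp add: periodic_def S_def)
  qed (use assms(1) C sol in \<open>auto simp: class_C_def is_solution_def\<close>)
  have "x t $ i = x 0 $ i" if "0 \<le> t" for t i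
    using constant_on_atLeastD[OF const that] .
  then have "x t = x 0" if "0 \<le> t" for t
    unfolding vec_eq_iff using that by blast
  then have "x constant_on {0..}"
    unfolding constant_on_def by (metis atLeast_iff)
  with nonconst show False ..
qed

end
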